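(* Let $X$ be a bounded distributive lattice, $Y$ a bounded chain, $n\geqslant 1$ an integer, and $f\colon X^n\to Y$ an order-preserving function whose diagonal section $\delta_f$ is a lattice homomorphism. Then $f$ is a quasi-polynomial function if and only if it is quasi-comonotonic minitive and quasi-comonotonic maxitive.
   Context: The lattice operations are denoted $\wedge,\vee$ and the least and greatest elements $0$ and $1$ (in either lattice). $X^n$ is regarded as a lattice with componentwise operations and order. Write $[n]=\{1,\ldots,n\}$ and $\mathrm{med}(a,b,c)=(a\wedge b)\vee(b\wedge c)\vee(c\wedge a)$. A chain is a totally ordered lattice. A lattice homomorphism is a map preserving $\wedge$ and $\vee$ (it is not required to preserve $0$ and $1$). A (lattice) polynomial function $p\colon Y^n\to Y$ is any map which can be obtained as a composition of the lattice operations $\wedge$ and $\vee$, the projections $\mathbf{y}\mapsto y_i$ ($i\in[n]$), and the constant functions $\mathbf{y}\mapsto c$ ($c\in Y$). A function $f\colon X^n\to Y$ is a quasi-polynomial function if there exist a polynomial function $p\colon Y^n\to Y$ and a unary function $\varphi\colon X\to Y$ satisfying $\varphi(x)=\mathrm{med}(\varphi(0),\varphi(x),\varphi(1))$ for every $x\in X$, such that $f(x_1,\ldots,x_n)=p(\varphi(x_1),\ldots,\varphi(x_n))$ for all $x_1,\ldots,x_n\in X$. The diagonal section of $f$ is $\delta_f\colon X\to Y$, $\delta_f(x)=f(x,\ldots,x)$; for $\mathbf{x}\in X^n$, $\delta_f(\mathbf{x})=(\delta_f(x_1),\ldots,\delta_f(x_n))$. For a permutation $\sigma$ on $[n]$,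 $Y^n_\sigma=\{\mathbf{y}\in Y^n : y_{\sigma(1)}\leqslant y_{\sigma(2)}\leqslant\cdots\leqslant y_{\sigma(n)}\}$. $f$ is quasi-comonotonic minitive (resp. quasi-comonotonic maxitive) if for every permutation $\sigma$ on $[n]$ and every $\mathbf{x},\mathbf{x}'\in X^n$ such that $\delta_f(\mathbf{x}),\delta_f(\mathbf{x}')\in Y^n_\sigma$, we have $f(\mathbf{x}\wedge\mathbf{x}')=f(\mathbf{x})\wedge f(\mathbf{x}')$ (resp. $f(\mathbf{x}\vee\mathbf{x}')=f(\mathbf{x})\vee f(\mathbf{x}')$). *)

theory Defs
  imports Main
begin

text \<open>
  An \<open>n\<close>-tuple over \<open>'a\<close> is a function \<open>'n \<Rightarrow> 'a\<close>, where the linearly ordered finite index type \<open>'n\<close>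
  plays the role of \<open>{1,\<dots>,n}\<close> (so \<open>n = CARD('n) \<ge> 1\<close>). The library's pointwise order, \<open>inf\<close> and
  \<open>sup\<close> on functions are the componentwise ones on the power of a lattice.
\<close>

definition med :: "'a::lattice \<Rightarrow> 'a \<Rightarrow> 'a \<Rightarrow> 'a" where
  "med a b c = sup (sup (inf a b) (inf b c)) (inf c a)"

definition lattice_hom :: "('a::lattice \<Rightarrow> 'b::lattice) \<Rightarrow> bool" where
  "lattice_hom h \<longleftrightarrow>
    (\<forall>x y. h (inf x y) = inf (h x) (h y)) \<and> (\<forall>x y. h (sup x y) = sup (h x) (h y))"

inductive polynomial_function :: "(('n \<Rightarrow> 'y::lattice) \<Rightarrow> 'y) \<Rightarrow> bool" where
  proj: "polynomial_function (\<lambda>y. y i)"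
| const: "polynomial_function (\<lambda>y. c)"
| inf: "polynomial_function p \<Longrightarrow> polynomial_function q \<Longrightarrow> polynomial_function (\<lambda>y. inf (p y) (q y))"
| sup: "polynomial_function p \<Longrightarrow> polynomial_function q \<Longrightarrow> polynomial_function (\<lambda>y. sup (p y) (q y))"

definition quasi_polynomial_function ::
    "(('n \<Rightarrow> 'x::bounded_lattice) \<Rightarrow> 'y::lattice) \<Rightarrow> bool" where
  "quasi_polynomial_function f \<longleftrightarrow>
    (\<exists>(p :: ('n \<Rightarrow> 'y) \<Rightarrow> 'y) (\<phi> :: 'x \<Rightarrow> 'y).
      polynomial_function p \<and>
      (\<forall>x. \<phi> x = med (\<phi> bot) (\<phi> x) (\<phi> top)) \<and>
      (\<forall>x. f x = p (\<lambda>i. \<phi> (x i))))"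

definition diagonal_section :: "(('n \<Rightarrow> 'x) \<Rightarrow> 'y) \<Rightarrow> 'x \<Rightarrow> 'y" where
  "diagonal_section f x = f (\<lambda>_. x)"

definition ordered_tuples :: "('n::linorder \<Rightarrow> 'n) \<Rightarrow> ('n \<Rightarrow> 'y::order) set" where
  "ordered_tuples \<sigma> = {y. \<forall>i j. i \<le> j \<longrightarrow> y (\<sigma> i) \<le> y (\<sigma> j)}"

definition quasi_comonotonic_minitive ::
    "(('n::{finite,linorder} \<Rightarrow> 'x::lattice) \<Rightarrow> 'y::lattice) \<Rightarrow> bool" where
  "quasi_comonotonic_minitive f \<longleftrightarrow>
    (\<forall>\<sigma> :: 'n \<Rightarrow> 'n. bij \<sigma> \<longrightarrow>
      (\<forall>x x'. (\<lambda>i. diagonal_section f (x i)) \<in> ordered_tuples \<sigma> \<longrightarrow>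
              (\<lambda>i. diagonal_section f (x' i)) \<in> ordered_tuples \<sigma> \<longrightarrow>
              f (inf x x') = inf (f x) (f x')))"

definition quasi_comonotonic_maxitive ::
    "(('n::{finite,linorder} \<Rightarrow> 'x::lattice) \<Rightarrow> 'y::lattice) \<Rightarrow> bool" where
  "quasi_comonotonic_maxitive f \<longleftrightarrow>
    (\<forall>\<sigma> :: 'n \<Rightarrow> 'n. bij \<sigma> \<longrightarrow>
      (\<forall>x x'. (\<lambda>i. diagonal_section f (x i)) \<in> ordered_tuples \<sigma> \<longrightarrow>
              (\<lambda>i. diagonal_section f (x' i)) \<in> ordered_tuples \<sigma> \<longrightarrow>
              f (sup x x') = sup (f x) (f x')))"

end

theory Submission
  imports Defs
begin

text \<open>
  Both sides of the equivalence say that \<open>f\<close> is determined by the level sets of its diagonal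
  section \<open>\<delta>\<close>: for every threshold \<open>c\<close>, whether \<open>c \<le> f x\<close> holds depends, monotonically, only on
  the index set \<open>{i. c \<le> \<delta> (x i)}\<close>. This property is called \<open>level_determined\<close> below.

  A polynomial function \<open>p\<close> over a chain has the analogous property with respect to its arguments,
  because \<open>c \<le> inf a b\<close> and \<open>c \<le> sup a b\<close> are the conjunction and the disjunction of \<open>c \<le> a\<close> and
  \<open>c \<le> b\<close>. For \<open>f x = p (\<phi> \<circ> x)\<close> the level sets of \<open>\<phi>\<close> and of \<open>\<delta>\<close> agree at all thresholds strictly
  above \<open>p\<close>'s least value and not above its greatest one, and no other threshold matters; so
  quasi-polynomial functions are level-determined. Conversely, a level-determined \<open>f\<close> is the
  disjunctive normal form \<open>\<Or>\<^sub>I (f 1\<^sub>I \<and> \<And>\<^sub>i\<^sub>\<in>\<^sub>I \<delta> (x i))\<close>, where \<open>1\<^sub>I\<close> is the characteristic tuple of \<open>I\<close>.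

  Comonotonicity enters as follows: if the images under \<open>\<delta>\<close> of two tuples are sorted by the same
  permutation, then their level sets at any threshold are nested, and since \<open>\<delta>\<close> is a homomorphism,
  the level set of the meet (join) is one of the two given level sets. This makes
  level-determined functions quasi-comonotonic minitive and maxitive. Conversely,
  a constant tuple is sorted by every permutation, so the two comonotonicity properties apply to
  \<open>1\<^sub>I\<close> together with a constant tuple. This compares \<open>f x\<close> from above, and \<open>f x'\<close> from below,
  with the single value \<open>f 1\<^sub>I\<close>, where \<open>I\<close> is the level set of \<open>x\<close>.
\<close>

section \<open>Polynomial functions over a chain\<close>

lemma le_sup_iff_chain:
  fixes a b c :: "'y::{linorder,lattice}"
  shows "c \<le> sup a b \<longleftrightarrow> c \<le> a \<or> c \<le> b"
  by (cases "a \<le> b") (auto simp: sup_absorb1 sup_absorb2)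

text \<open>
  Over a chain, the map sending \<open>y\<close> to the truth value of \<open>c \<le> y\<close> is a lattice homomorphism into
  the two-element lattice, so it turns a polynomial function into a monotone Boolean function.
\<close>

lemma polynomial_function_level_mono:
  fixes p :: "('n \<Rightarrow> 'y::{linorder,lattice}) \<Rightarrow> 'y"
  assumes "polynomial_function p" and "\<And>i. c \<le> y i \<Longrightarrow> c \<le> z i" and "c \<le> p y"
  shows "c \<le> p z"
  using assms(1,3)
  by (induction rule: polynomial_function.induct) (auto simp: le_sup_iff_chain assms(2))

text \<open>
  Finite meets and joins are described by the elements below them: this is the form in which level
  sets see them, and it determines their values by antisymmetry.
\<close>

lemma ex_polynomial_Inf:
  fixes I :: "'n set"
  assumes "finite I"
  shows "\<exists>p :: ('n \<Rightarrow> 'y::bounded_lattice) \<Rightarrow> 'y. polynomial_function p \<and>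
           (\<forall>c y. c \<le> p y \<longleftrightarrow> (\<forall>i\<in>I. c \<le> y i))"
  using assms
proof (induction I rule: finite_induct)
  case empty
  show ?case
    by (rule exI[of _ "\<lambda>y. top"]) (auto intro: polynomial_function.const)
next
  case (insert j I)
  then obtain p :: "('n \<Rightarrow> 'y) \<Rightarrow> 'y" where
    "polynomial_function p" "\<forall>c y. c \<le> p y \<longleftrightarrow> (\<forall>i\<in>I. c \<le> y i)"
    by blast
  then show ?case
    by (intro exI[of _ "\<lambda>y. inf (y j) (p y)"])
      (auto intro: polynomial_function.inf polynomial_function.proj)
qed

lemma ex_polynomial_Sup:
  fixes q :: "'a \<Rightarrow> ('n \<Rightarrow> 'y::{linorder,lattice}) \<Rightarrow> 'y"
  assumes "finite A" "A \<noteq> {}" and "\<And>a. polynomial_function (q a)"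
  shows "\<exists>p. polynomial_function p \<and> (\<forall>c y. c \<le> p y \<longleftrightarrow> (\<exists>a\<in>A. c \<le> q a y))"
  using assms(1,2)
proof (induction A rule: finite_ne_induct)
  case (singleton a)
  then show ?case
    by (intro exI[of _ "q a"]) (auto intro: assms(3))
next
  case (insert a A)
  then obtain p where
    "polynomial_function p" "\<forall>c y. c \<le> p y \<longleftrightarrow> (\<exists>a\<in>A. c \<le> q a y)"
    by blast
  then show ?case
    by (intro exI[of _ "\<lambda>y. sup (q a y) (p y)"])
      (auto intro: polynomial_function.sup assms(3) simp: le_sup_iff_chain)
qed

section \<open>Level-determined functions\<close>

definition level_determined :: "(('n \<Rightarrow> 'x) \<Rightarrow> 'y::order) \<Rightarrow> bool" where
  "level_determined f \<longleftrightarrow>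
    (\<forall>c x x'. (\<forall>i. c \<le> diagonal_section f (x i) \<longrightarrow> c \<le> diagonal_section f (x' i)) \<longrightarrow>
       c \<le> f x \<longrightarrow> c \<le> f x')"

lemma level_determinedD:
  assumes "level_determined f"
    and "\<And>i. c \<le> diagonal_section f (x i) \<Longrightarrow> c \<le> diagonal_section f (x' i)"
    and "c \<le> f x"
  shows "c \<le> f x'"
  using assms unfolding level_determined_def by blast

lemma quasi_polynomial_imp_level_determined:
  fixes f :: "('n \<Rightarrow> 'x::bounded_lattice) \<Rightarrow> 'y::{linorder,bounded_lattice}"
  assumes "quasi_polynomial_function f"
  shows "level_determined f"
  unfolding level_determined_def
proof (intro allI impI)
  obtain p :: "('n \<Rightarrow> 'y) \<Rightarrow> 'y" and \<phi> where
    p: "polynomial_function p" and f: "\<And>x. f x = p (\<lambda>i. \<phi> (x i))"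
    using assms unfolding quasi_polynomial_function_def by blast
  note level = polynomial_function_level_mono[OF p]
  fix c x x'
  assume le: "\<forall>i. c \<le> diagonal_section f (x i) \<longrightarrow> c \<le> diagonal_section f (x' i)"
    and c: "c \<le> f x"
  show "c \<le> f x'"
  proof (cases "c \<le> p (\<lambda>_. bot)")
    case True
    then show ?thesis
      unfolding f by (rule level[rotated]) (simp add: bot_unique)
  next
    case False
    have "c \<le> p (\<lambda>_. top)"
      by (rule level[OF _ c[unfolded f]]) simp
    then have "c \<le> diagonal_section f u" if "c \<le> \<phi> u" for u
      unfolding diagonal_section_def f using that by (rule level[rotated])
    moreover have "c \<le> \<phi> u" if "c \<le> diagonal_section f u" for u
      \<comment> \<open>Otherwise the level set of the constant tuple \<open>\<phi> u\<close> is empty, which forces \<open>c \<le> p 0\<close>.\<close>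
      using that False level[of c "\<lambda>_. \<phi> u" "\<lambda>_. bot"]
      unfolding diagonal_section_def f by blast
    ultimately have "c \<le> \<phi> (x' i)" if "c \<le> \<phi> (x i)" for i
      using le that by blast
    then show ?thesis
      using c unfolding f by (rule level)
  qed
qed

lemma mono_diagonal_section:
  fixes f :: "('n \<Rightarrow> 'x::order) \<Rightarrow> 'y::order"
  assumes "mono f"
  shows "mono (diagonal_section f)"
  unfolding diagonal_section_def by (intro monoI monoD[OF assms]) (simp add: le_fun_def)

lemma med_eq_self:
  assumes "a \<le> b" "b \<le> c"
  shows "med a b c = b"
  using assms order_trans[OF assms]
  by (simp add: med_def inf_absorb1 inf_absorb2 sup_absorb1 sup_absorb2)

abbreviation char_tuple :: "'n set \<Rightarrow> 'n \<Rightarrow> 'x::bounded_lattice" where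
  "char_tuple I \<equiv> \<lambda>i. if i \<in> I then top else bot"

text \<open>
  The inner function of the representation is \<open>\<delta>\<close> itself, and the outer one the disjunctive normal
  form with coefficients \<open>f (char_tuple I)\<close>. A term of that form which is at least \<open>c\<close> certifies
  \<open>c \<le> f x\<close>, since \<open>x\<close> then has at least the level set of \<open>char_tuple I\<close>; conversely, if \<open>c \<le> f x\<close>,
  then the term for the level set \<open>I\<close> of \<open>x\<close> is such a certificate.
\<close>

lemma level_determined_imp_quasi_polynomial:
  fixes f :: "('n::finite \<Rightarrow> 'x::bounded_lattice) \<Rightarrow> 'y::{linorder,bounded_lattice}"
  assumes mono: "mono f" and level: "level_determined f"
  shows "quasi_polynomial_function f"
proof -
  let ?\<delta> = "diagonal_section f"
  have mono_\<delta>: "?\<delta> u \<le> ?\<delta> v" if "u \<le> v" for u v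
    using mono_diagonal_section[OF mono] that by (rule monoD)
  have "\<forall>I. \<exists>p :: ('n \<Rightarrow> 'y) \<Rightarrow> 'y. polynomial_function p \<and>
          (\<forall>c y. c \<le> p y \<longleftrightarrow> (\<forall>i\<in>I. c \<le> y i))"
    by (intro allI ex_polynomial_Inf) simp
  then obtain m :: "'n set \<Rightarrow> ('n \<Rightarrow> 'y) \<Rightarrow> 'y" where
    m: "\<And>I. polynomial_function (m I)" "\<And>I c y. c \<le> m I y \<longleftrightarrow> (\<forall>i\<in>I. c \<le> y i)"
    by metis
  have "\<exists>p. polynomial_function p \<and>
          (\<forall>c y. c \<le> p y \<longleftrightarrow> (\<exists>I\<in>UNIV. c \<le> inf (f (char_tuple I)) (m I y)))"
    by (rule ex_polynomial_Sup) (auto intro: polynomial_function.inf polynomial_function.const m(1))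
  then obtain p where p: "polynomial_function p"
    and le_p: "\<And>c y. c \<le> p y \<longleftrightarrow> (\<exists>I. c \<le> f (char_tuple I) \<and> (\<forall>i\<in>I. c \<le> y i))"
    by (auto simp: m(2))
  have "c \<le> f x \<longleftrightarrow> c \<le> p (\<lambda>i. ?\<delta> (x i))" for c x
  proof
    assume c: "c \<le> f x"
    let ?I = "{i. c \<le> ?\<delta> (x i)}"
    have levels: "c \<le> ?\<delta> (char_tuple ?I i)" if "c \<le> ?\<delta> (x i)" for i
      using that order_trans[OF that mono_\<delta>[OF top_greatest]] by simp
    have "c \<le> f (char_tuple ?I)"
      by (rule level_determinedD[OF level _ c]) (rule levels)
    then show "c \<le> p (\<lambda>i. ?\<delta> (x i))"
      unfolding le_p by (intro exI[of _ ?I]) simp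
  next
    assume "c \<le> p (\<lambda>i. ?\<delta> (x i))"
    then obtain I where c: "c \<le> f (char_tuple I)" and I: "\<And>i. i \<in> I \<Longrightarrow> c \<le> ?\<delta> (x i)"
      unfolding le_p by blast
    have levels: "c \<le> ?\<delta> (x i)" if "c \<le> ?\<delta> (char_tuple I i)" for i
      using that I order_trans[OF _ mono_\<delta>[OF bot_least]] by (cases "i \<in> I") auto
    show "c \<le> f x"
      by (rule level_determinedD[OF level _ c]) (rule levels)
  qed
  then have "f x = p (\<lambda>i. ?\<delta> (x i))" for x
    by (meson order_antisym order_refl)
  moreover have "?\<delta> u = med (?\<delta> bot) (?\<delta> u) (?\<delta> top)" for u
    by (simp add: med_eq_self mono_\<delta>)
  ultimately show ?thesis
    unfolding quasi_polynomial_function_def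
    by (intro exI[of _ p] exI[of _ ?\<delta>]) (simp add: p)
qed

section \<open>From level sets to comonotonicity\<close>

lemma ordered_tuples_nested_levels:
  fixes \<sigma> :: "'n::linorder \<Rightarrow> 'n" and c :: "'y::order"
  assumes "bij \<sigma>" "y \<in> ordered_tuples \<sigma>" "z \<in> ordered_tuples \<sigma>"
  shows "(\<forall>i. c \<le> y i \<longrightarrow> c \<le> z i) \<or> (\<forall>i. c \<le> z i \<longrightarrow> c \<le> y i)"
proof (rule ccontr)
  assume "\<not> ?thesis"
  then obtain a b where ab: "c \<le> y (\<sigma> a)" "\<not> c \<le> z (\<sigma> a)" "c \<le> z (\<sigma> b)" "\<not> c \<le> y (\<sigma> b)"
    using bij_is_surj[OF assms(1)] by (metis surjD)
  show False
  proof (cases "a \<le> b")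
    case True
    then have "y (\<sigma> a) \<le> y (\<sigma> b)"
      using assms(2) by (simp add: ordered_tuples_def)
    then show False
      using ab(1,4) order_trans by blast
  next
    case False
    then have "z (\<sigma> b) \<le> z (\<sigma> a)"
      using assms(3) by (simp add: ordered_tuples_def)
    then show False
      using ab(2,3) order_trans by blast
  qed
qed

lemma level_determined_imp_minitive:
  fixes f :: "('n::{finite,linorder} \<Rightarrow> 'x::lattice) \<Rightarrow> 'y::{linorder,lattice}"
  assumes mono: "mono f" and hom: "lattice_hom (diagonal_section f)"
    and level: "level_determined f"
  shows "quasi_comonotonic_minitive f"
  unfolding quasi_comonotonic_minitive_def
proof (intro allI impI)
  let ?\<delta> = "diagonal_section f"
  fix \<sigma> :: "'n \<Rightarrow> 'n" and x x'
  assume "bij \<sigma>" "(\<lambda>i. ?\<delta> (x i)) \<in> ordered_tuples \<sigma>" "(\<lambda>i. ?\<delta> (x' i)) \<in> ordered_tuples \<sigma>"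
  note nested = ordered_tuples_nested_levels[OF this]
  have \<delta>_inf: "?\<delta> (inf u v) = inf (?\<delta> u) (?\<delta> v)" for u v
    using hom by (simp add: lattice_hom_def)
  let ?c = "inf (f x) (f x')"
  have "?c \<le> f (inf x x')"
    using nested[of ?c]
  proof
    assume le: "\<forall>i. ?c \<le> ?\<delta> (x i) \<longrightarrow> ?c \<le> ?\<delta> (x' i)"
    show ?thesis
      by (rule level_determinedD[OF level, of ?c x]) (use le in \<open>auto simp: \<delta>_inf\<close>)
  next
    assume le: "\<forall>i. ?c \<le> ?\<delta> (x' i) \<longrightarrow> ?c \<le> ?\<delta> (x i)"
    show ?thesis
      by (rule level_determinedD[OF level, of ?c x']) (use le in \<open>auto simp: \<delta>_inf\<close>)
  qed
  then show "f (inf x x') = ?c"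
    by (intro order_antisym) (auto intro: monoD[OF mono])
qed

lemma level_determined_imp_maxitive:
  fixes f :: "('n::{finite,linorder} \<Rightarrow> 'x::lattice) \<Rightarrow> 'y::{linorder,lattice}"
  assumes mono: "mono f" and hom: "lattice_hom (diagonal_section f)"
    and level: "level_determined f"
  shows "quasi_comonotonic_maxitive f"
  unfolding quasi_comonotonic_maxitive_def
proof (intro allI impI)
  let ?\<delta> = "diagonal_section f"
  fix \<sigma> :: "'n \<Rightarrow> 'n" and x x'
  assume "bij \<sigma>" "(\<lambda>i. ?\<delta> (x i)) \<in> ordered_tuples \<sigma>" "(\<lambda>i. ?\<delta> (x' i)) \<in> ordered_tuples \<sigma>"
  note nested = ordered_tuples_nested_levels[OF this]
  have \<delta>_sup: "?\<delta> (sup u v) = sup (?\<delta> u) (?\<delta> v)" for u v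
    using hom by (simp add: lattice_hom_def)
  let ?c = "f (sup x x')"
  have "?c \<le> sup (f x) (f x')"
    using nested[of ?c]
  proof
    assume le: "\<forall>i. ?c \<le> ?\<delta> (x i) \<longrightarrow> ?c \<le> ?\<delta> (x' i)"
    have "?c \<le> f x'"
      by (rule level_determinedD[OF level, of ?c "sup x x'"])
        (use le in \<open>auto simp: \<delta>_sup le_sup_iff_chain\<close>)
    then show ?thesis
      by (rule le_supI2)
  next
    assume le: "\<forall>i. ?c \<le> ?\<delta> (x' i) \<longrightarrow> ?c \<le> ?\<delta> (x i)"
    have "?c \<le> f x"
      by (rule level_determinedD[OF level, of ?c "sup x x'"])
        (use le in \<open>auto simp: \<delta>_sup le_sup_iff_chain\<close>)
    then show ?thesis
      by (rule le_supI1)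
  qed
  then show "?c = sup (f x) (f x')"
    by (intro order_antisym) (auto intro: monoD[OF mono])
qed

section \<open>From comonotonicity to level sets\<close>

lemma ex_sorting_permutation:
  fixes y :: "'n::{finite,linorder} \<Rightarrow> 'y::linorder"
  shows "\<exists>\<sigma>. bij \<sigma> \<and> y \<in> ordered_tuples \<sigma>"
proof -
  define L where "L = sort_key y (sorted_list_of_set (UNIV :: 'n set))"
  define rank where "rank i = card {..<i}" for i :: 'n
  have L: "distinct L" "sorted (map y L)" "length L = card (UNIV :: 'n set)"
    unfolding L_def by simp_all
  have rank_less: "rank i < rank j" if "i < j" for i j
    unfolding rank_def using that by (intro psubset_card_mono) auto
  have rank_bound: "rank i < length L" for i
    unfolding rank_def L(3) by (intro psubset_card_mono) auto
  have "inj (\<lambda>i. L ! rank i)"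
    by (intro injI) (metis L(1) nth_eq_iff_index_eq rank_bound rank_less less_irrefl neqE)
  then have "bij (\<lambda>i. L ! rank i)"
    by (simp add: bij_def finite_UNIV_inj_surj)
  moreover have "y (L ! rank i) \<le> y (L ! rank j)" if "i \<le> j" for i j
    using sorted_nth_mono[OF L(2), of "rank i" "rank j"] that rank_less[of i j] rank_bound
    by (cases "i = j") (auto simp: less_le)
  ultimately show ?thesis
    unfolding ordered_tuples_def by blast
qed

lemma const_in_ordered_tuples: "(\<lambda>_. a) \<in> ordered_tuples \<sigma>"
  by (simp add: ordered_tuples_def)

lemma minitive_inf_const:
  assumes "quasi_comonotonic_minitive (f :: ('n::{finite,linorder} \<Rightarrow> _) \<Rightarrow> 'y::{linorder,lattice})"
  shows "f (inf x (\<lambda>_. t)) = inf (f x) (diagonal_section f t)"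
proof -
  obtain \<sigma> where "bij \<sigma>" "(\<lambda>i. diagonal_section f (x i)) \<in> ordered_tuples \<sigma>"
    using ex_sorting_permutation by blast
  with assms[unfolded quasi_comonotonic_minitive_def, rule_format, of \<sigma> x "\<lambda>_. t"] show ?thesis
    by (simp add: const_in_ordered_tuples) (simp add: diagonal_section_def)
qed

lemma maxitive_sup_const:
  assumes "quasi_comonotonic_maxitive (f :: ('n::{finite,linorder} \<Rightarrow> _) \<Rightarrow> 'y::{linorder,lattice})"
  shows "f (sup x (\<lambda>_. t)) = sup (f x) (diagonal_section f t)"
proof -
  obtain \<sigma> where "bij \<sigma>" "(\<lambda>i. diagonal_section f (x i)) \<in> ordered_tuples \<sigma>"
    using ex_sorting_permutation by blast
  with assms[unfolded quasi_comonotonic_maxitive_def, rule_format, of \<sigma> x "\<lambda>_. t"] show ?thesis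
    by (simp add: const_in_ordered_tuples) (simp add: diagonal_section_def)
qed

lemma lattice_hom_ex_upper_bound:
  fixes h :: "'x::bounded_lattice \<Rightarrow> 'y::{linorder,lattice}"
  assumes "lattice_hom h" "finite A" "\<not> c \<le> h bot" "\<And>i. i \<in> A \<Longrightarrow> \<not> c \<le> h (x i)"
  shows "\<exists>u. \<not> c \<le> h u \<and> (\<forall>i\<in>A. x i \<le> u)"
  using assms(2,4)
proof (induction A rule: finite_induct)
  case empty
  then show ?case
    using assms(3) by auto
next
  case (insert j A)
  then obtain u where u: "\<not> c \<le> h u" "\<forall>i\<in>A. x i \<le> u"
    by blast
  have "\<not> c \<le> h (sup (x j) u)"
    using u(1) insert.prems assms(1) by (simp add: lattice_hom_def le_sup_iff_chain)
  then show ?case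
    using u(2) by (intro exI[of _ "sup (x j) u"]) (auto intro: le_supI2)
qed

lemma lattice_hom_ex_lower_bound:
  fixes h :: "'x::bounded_lattice \<Rightarrow> 'y::lattice"
  assumes "lattice_hom h" "finite A" "c \<le> h top" "\<And>i. i \<in> A \<Longrightarrow> c \<le> h (x i)"
  shows "\<exists>t. c \<le> h t \<and> (\<forall>i\<in>A. t \<le> x i)"
  using assms(2,4)
proof (induction A rule: finite_induct)
  case empty
  then show ?case
    using assms(3) by auto
next
  case (insert j A)
  then obtain t where t: "c \<le> h t" "\<forall>i\<in>A. t \<le> x i"
    by blast
  have "c \<le> h (inf (x j) t)"
    using t(1) insert.prems assms(1) by (simp add: lattice_hom_def)
  then show ?case
    using t(2) by (intro exI[of _ "inf (x j) t"]) (auto intro: le_infI2)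
qed

text \<open>
  Let \<open>I\<close> be the level set of \<open>x\<close> at \<open>c\<close>, and suppose \<open>\<delta> 0 < c\<close>, since otherwise \<open>c \<le> \<delta> 0 \<le> f x'\<close>.
  Raising \<open>x\<close> to \<open>1\<close> on \<open>I\<close> and to a common bound \<open>u\<close> with
  \<open>\<delta> u < c\<close> off \<open>I\<close> shows \<open>c \<le> f x \<le> sup (f 1\<^sub>I) (\<delta> u)\<close>, so that \<open>c \<le> f 1\<^sub>I\<close>. Lowering \<open>x'\<close> to a
  common bound \<open>t\<close> with \<open>c \<le> \<delta> t\<close> on \<open>I\<close> and to \<open>0\<close> off \<open>I\<close> shows \<open>f x' \<ge> inf (f 1\<^sub>I) (\<delta> t) \<ge> c\<close>.
  The bounds \<open>u\<close> and \<open>t\<close> are a finite join and a finite meet of entries; that \<open>\<delta> u < c\<close> survives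
  the join is due to \<open>Y\<close> being a chain.
\<close>

lemma comonotonic_imp_level_determined:
  fixes f :: "('n::{finite,linorder} \<Rightarrow> 'x::bounded_lattice) \<Rightarrow> 'y::{linorder,lattice}"
  assumes mono: "mono f" and hom: "lattice_hom (diagonal_section f)"
    and mini: "quasi_comonotonic_minitive f" and maxi: "quasi_comonotonic_maxitive f"
  shows "level_determined f"
  unfolding level_determined_def
proof (intro allI impI)
  let ?\<delta> = "diagonal_section f"
  fix c x x'
  assume le: "\<forall>i. c \<le> ?\<delta> (x i) \<longrightarrow> c \<le> ?\<delta> (x' i)" and c: "c \<le> f x"
  define I where "I = {i. c \<le> ?\<delta> (x i)}"
  show "c \<le> f x'"
  proof (cases "c \<le> ?\<delta> bot")
    case True
    also have "?\<delta> bot \<le> f x'"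
      unfolding diagonal_section_def by (intro monoD[OF mono]) (simp add: le_fun_def)
    finally show ?thesis .
  next
    case False
    have "\<exists>u. \<not> c \<le> ?\<delta> u \<and> (\<forall>i\<in>- I. x i \<le> u)"
      by (rule lattice_hom_ex_upper_bound[OF hom _ False]) (simp_all add: I_def)
    then obtain u where u: "\<not> c \<le> ?\<delta> u" "\<And>i. i \<notin> I \<Longrightarrow> x i \<le> u"
      by blast
    note c
    also have "f x \<le> f (sup (char_tuple I) (\<lambda>_. u))"
      using u(2) by (intro monoD[OF mono]) (simp add: le_fun_def)
    also have "\<dots> = sup (f (char_tuple I)) (?\<delta> u)"
      using maxi by (rule maxitive_sup_const)
    finally have c_le: "c \<le> f (char_tuple I)"
      using u(1) by (simp add: le_sup_iff_chain)
    note c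
    also have "f x \<le> ?\<delta> top"
      unfolding diagonal_section_def by (intro monoD[OF mono]) (simp add: le_fun_def)
    finally have "c \<le> ?\<delta> top" .
    then have "\<exists>t. c \<le> ?\<delta> t \<and> (\<forall>i\<in>I. t \<le> x' i)"
      by (rule lattice_hom_ex_lower_bound[OF hom, rotated]) (use le in \<open>simp_all add: I_def\<close>)
    then obtain t where t: "c \<le> ?\<delta> t" "\<And>i. i \<in> I \<Longrightarrow> t \<le> x' i"
      by blast
    have "c \<le> inf (f (char_tuple I)) (?\<delta> t)"
      using c_le t(1) by simp
    also have "\<dots> = f (inf (char_tuple I) (\<lambda>_. t))"
      using mini by (rule minitive_inf_const[symmetric])
    also have "\<dots> \<le> f x'"
      using t(2) by (intro monoD[OF mono]) (simp add: le_fun_def)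
    finally show ?thesis .
  qed
qed

theorem theorem14:
  fixes f :: "('n::{finite,linorder} \<Rightarrow> 'x::{distrib_lattice,bounded_lattice})
              \<Rightarrow> 'y::{linorder,bounded_lattice}"
  assumes "mono f"
    and "lattice_hom (diagonal_section f)"
  shows "quasi_polynomial_function f \<longleftrightarrow>
         quasi_comonotonic_minitive f \<and> quasi_comonotonic_maxitive f"
proof
  assume "quasi_polynomial_function f"
  then have "level_determined f"
    by (rule quasi_polynomial_imp_level_determined)
  then show "quasi_comonotonic_minitive f \<and> quasi_comonotonic_maxitive f"
    using level_determined_imp_minitive[OF assms] level_determined_imp_maxitive[OF assms] by simp
next
  assume "quasi_comonotonic_minitive f \<and> quasi_comonotonic_maxitive f"
  then have "level_determined f"
    using comonotonic_imp_level_determined[OF assms] by simp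
  with assms(1) show "quasi_polynomial_function f"
    by (rule level_determined_imp_quasi_polynomial)
qed

end
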